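(* Let $G$ be a finite $p$-group ($p$ a prime). Then the deleted enhanced power graph $\mathcal{G}^*_e(G)$ is connected if and only if $G$ has a unique minimal subgroup.
   Context: For a group $G$, the enhanced power graph $\mathcal{G}_e(G)$ is the simple undirected graph with vertex set $G$ in which two distinct vertices $x,y$ are adjacent if there exists $z\in G$ with $x=z^m$ and $y=z^n$ for some $m,n\in\mathbb{N}$. The deleted enhanced power graph $\mathcal{G}^*_e(G)$ is the induced subgraph of $\mathcal{G}_e(G)$ on $G\setminus\{e\}$, where $e$ is the identity. A minimal subgroup means a minimal nontrivial subgroup. *)

theory Defs
  imports
    "HOL-Computational_Algebra.Primes"
    "HOL-Algebra.Multiplicative_Group"
    "Graph_Theory.Digraph_Component"
begin

definition p_group :: "nat \<Rightarrow> ('a, 'b) monoid_scheme \<Rightarrow> bool" where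
  "p_group p G \<longleftrightarrow> group G \<and> (\<exists>n::nat. order G = p ^ n)"

definition minimal_subgroup :: "'a set \<Rightarrow> ('a, 'b) monoid_scheme \<Rightarrow> bool" where
  "minimal_subgroup H G \<longleftrightarrow>
     subgroup H G \<and> H \<noteq> {\<one>\<^bsub>G\<^esub>} \<and>
     (\<forall>K. subgroup K G \<longrightarrow> K \<noteq> {\<one>\<^bsub>G\<^esub>} \<longrightarrow> K \<subseteq> H \<longrightarrow> K = H)"

text \<open>
  As usual in the library, an undirected simple graph is a symmetric loop-free
  digraph whose arcs are pairs of vertices. The exponents may be zero. In a finite group this is
  the same as requiring them to be positive, and two non-identity elements are never made
  adjacent by a zero exponent.
\<close>

definition enhanced_power_graph :: "('a, 'b) monoid_scheme \<Rightarrow> 'a pair_pre_digraph" where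
  "enhanced_power_graph G =
     \<lparr> pverts = carrier G,
       parcs = {(x, y). x \<in> carrier G \<and> y \<in> carrier G \<and> x \<noteq> y \<and>
                  (\<exists>z \<in> carrier G. \<exists>(m::nat) (n::nat). x = z [^]\<^bsub>G\<^esub> m \<and> y = z [^]\<^bsub>G\<^esub> n)} \<rparr>"

definition deleted_enhanced_power_graph ::
  "('a, 'b) monoid_scheme \<Rightarrow> ('a, 'a \<times> 'a) pre_digraph" where
  "deleted_enhanced_power_graph G =
     with_proj (enhanced_power_graph G) \<restriction> (carrier G - {\<one>\<^bsub>G\<^esub>})"

lemma pair_bidirected_digraph_enhanced_power_graph:
  "pair_bidirected_digraph (enhanced_power_graph G)"
  by unfold_locales (auto simp: enhanced_power_graph_def symmetric_def intro!: symI)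

lemma induced_subgraph_deleted_enhanced_power_graph:
  "induced_subgraph (deleted_enhanced_power_graph G) (with_proj (enhanced_power_graph G))"
proof -
  interpret pair_bidirected_digraph "enhanced_power_graph G"
    by (rule pair_bidirected_digraph_enhanced_power_graph)
  show ?thesis
    unfolding deleted_enhanced_power_graph_def
    by (rule induced_induce) (auto simp: enhanced_power_graph_def)
qed

text \<open>
  The library's \<^const>\<open>Digraph_Component.connected\<close> requires a nonempty vertex set. So for the
  trivial group, which has no minimal subgroup, the deleted graph is empty and not connected.
\<close>

end

theory Submission
  imports Defs
begin

text \<open>
  In a cyclic \<open>p\<close>-group the subgroups form a chain, so of two adjacent vertices one generates a
  subgroup containing the other. Hence the minimal subgroup contained in \<open>\<langle>x\<rangle>\<close> does not change
  along an edge of the deleted graph, and a connected graph admits only one minimal subgroup.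
  Conversely, a generator of a unique minimal subgroup is a power of every non-identity element,
  so that every vertex is equal or adjacent to it.
\<close>

text \<open>Adjacency is already symmetric, so the symmetric closure inside \<open>connected\<close>
  adds no arcs, and what remains is reachability by adjacency steps within \<open>V\<close>.\<close>

lemma connected_deleted_enhanced_power_graph_iff:
  fixes G :: "('a, 'b) monoid_scheme"
  defines "V \<equiv> carrier G - {\<one>\<^bsub>G\<^esub>}"
  shows "Digraph_Component.connected (deleted_enhanced_power_graph G) \<longleftrightarrow>
         V \<noteq> {} \<and> (\<forall>u\<in>V. \<forall>v\<in>V. (u, v) \<in> rtrancl_on V (parcs (enhanced_power_graph G) \<inter> V \<times> V))"
proof -
  have "sym (parcs (enhanced_power_graph G))"
    by (auto simp: enhanced_power_graph_def intro!: symI)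
  then have "arcs_ends (with_proj (mk_symmetric (deleted_enhanced_power_graph G))) =
        parcs (enhanced_power_graph G) \<inter> V \<times> V"
    unfolding deleted_enhanced_power_graph_def mk_symmetric_def V_def arcs_ends_def arc_to_ends_def
    by (auto dest: symD)
  moreover have "verts (with_proj (mk_symmetric (deleted_enhanced_power_graph G))) = V"
    by (simp add: deleted_enhanced_power_graph_def mk_symmetric_def V_def)
  ultimately show ?thesis
    by (simp add: connected_def strongly_connected_def reachable_def)
qed

context group
begin

text \<open>Exponents of \<open>z\<close> matter only modulo \<open>order G\<close>, and by Bezout
  \<open>gcd j (order G)\<close> is a multiple of \<open>j\<close> modulo \<open>order G\<close>;
  hence so is \<open>i\<close>.\<close>

lemma pow_eq_pow_pow_if_gcd_dvd:
  assumes "z \<in> carrier G" "gcd j (order G) dvd i"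
  shows "\<exists>t::nat. z [^] i = (z [^] j) [^] t"
proof (cases "j = 0")
  \<comment> \<open>Bezout over the naturals needs \<open>j\<close> nonzero. Here the gcd is
    \<open>order G\<close> itself, so \<open>z [^] i\<close> is the identity.\<close>
  case True
  then have "z [^] i = \<one>"
    using assms pow_order_eq_1[OF assms(1)] by (auto simp: nat_pow_pow[symmetric])
  then show ?thesis
    by (auto intro!: exI[of _ "0::nat"])
next
  case False
  then obtain u v where "j * u = order G * v + gcd j (order G)"
    using bezout_nat by blast
  then have "z [^] (j * u) = z [^] gcd j (order G)"
    using assms(1) pow_order_eq_1[OF assms(1)]
    by (simp add: nat_pow_mult[symmetric] nat_pow_pow[symmetric])
  moreover obtain q where "i = gcd j (order G) * q"
    using assms(2) by blast
  ultimately have "z [^] i = (z [^] j) [^] (u * q)"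
    using assms(1) by (metis mult.assoc nat_pow_pow)
  then show ?thesis ..
qed

text \<open>The gcds of \<open>i\<close> and \<open>j\<close> with \<open>order G\<close> divide a
  power of \<open>p\<close>, so both are powers of \<open>p\<close> and one divides the other. This
  is the chain property of cyclic \<open>p\<close>-groups in terms of exponents.\<close>

lemma pow_comparable_if_p_group:
  assumes "prime p" "p_group p G" "z \<in> carrier G"
  shows "(\<exists>t::nat. z [^] (i::nat) = (z [^] (j::nat)) [^] t) \<or> (\<exists>t::nat. z [^] j = (z [^] i) [^] t)"
proof -
  obtain n where n: "order G = p ^ n"
    using assms(2) by (auto simp: p_group_def)
  obtain r s where "gcd i (order G) = p ^ r" "gcd j (order G) = p ^ s"
    using divides_primepow_nat[OF assms(1)] n by (metis gcd_dvd2)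
  then have "gcd j (order G) dvd gcd i (order G) \<or> gcd i (order G) dvd gcd j (order G)"
    using le_imp_power_dvd[of r s p] le_imp_power_dvd[of s r p] by (cases "r \<le> s") auto
  then show ?thesis
    using pow_eq_pow_pow_if_gcd_dvd[OF assms(3)] by (meson dvd_trans gcd_dvd1)
qed

lemma generate_singleton_subset_iff:
  assumes "subgroup H G" "x \<in> carrier G"
  shows "generate G {x} \<subseteq> H \<longleftrightarrow> x \<in> H"
  using generate_subgroup_incl[of "{x}" H] generate.incl[of x "{x}"] assms by blast

lemma generate_singleton_neq_one:
  assumes "x \<noteq> \<one>"
  shows "generate G {x} \<noteq> {\<one>}"
  using generate.incl[of x "{x}"] assms by blast

lemma generate_eq_minimal_subgroup:
  assumes "minimal_subgroup H G" "x \<in> H" "x \<noteq> \<one>"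
  shows "generate G {x} = H"
proof -
  have H: "subgroup H G" and x: "x \<in> carrier G"
    using assms(1,2) by (auto simp: minimal_subgroup_def subgroup.mem_carrier)
  then have "subgroup (generate G {x}) G" "generate G {x} \<subseteq> H"
    using assms(2) by (simp_all add: generate_is_subgroup generate_singleton_subset_iff)
  then show ?thesis
    using assms(1) generate_singleton_neq_one[OF assms(3)] by (simp add: minimal_subgroup_def)
qed

lemma minimal_subgroup_obtain_non_one:
  assumes "minimal_subgroup H G"
  obtains x where "x \<in> H" "x \<in> carrier G" "x \<noteq> \<one>"
  using assms subgroup.one_closed[of H G] subgroup.subset[of H G]
  by (auto simp: minimal_subgroup_def)

text \<open>The family of nontrivial subgroups is finite, so below each member lies one that is
  minimal under inclusion.\<close>

lemma exists_minimal_subgroup: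
  assumes "finite (carrier G)" "subgroup H G" "H \<noteq> {\<one>}"
  shows "\<exists>K. minimal_subgroup K G \<and> K \<subseteq> H"
proof -
  let ?S = "{K. subgroup K G \<and> K \<noteq> {\<one>}}"
  have "?S \<subseteq> Pow (carrier G)"
    using subgroup.subset by blast
  then have "finite ?S"
    using assms(1) finite_subset by blast
  then obtain K where "K \<in> ?S" "K \<subseteq> H" "\<forall>L\<in>?S. L \<subseteq> K \<longrightarrow> K = L"
    using finite_has_minimal2[of ?S H] assms(2,3) by auto
  then show ?thesis
    by (auto simp: minimal_subgroup_def)
qed

text \<open>One edge of the invariance argument. Both \<open>y\<close> and a generator
  \<open>a\<close> of \<open>M\<close> are powers of the common root \<open>z\<close>, so one of
  them is a power of the other. If \<open>y\<close> is a power of \<open>a\<close>, then it is a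
  non-identity element of \<open>M\<close> and generates \<open>M\<close>.\<close>

lemma minimal_subgroup_le_generate_edge:
  assumes "prime p" "p_group p G"
    and M: "minimal_subgroup M G" and "M \<subseteq> generate G {x}"
    and xy: "(x, y) \<in> parcs (enhanced_power_graph G)" and "y \<noteq> \<one>"
  shows "M \<subseteq> generate G {y}"
proof -
  obtain z and m n :: nat where z: "z \<in> carrier G" "x = z [^] m" "y = z [^] n"
    using xy by (auto simp: enhanced_power_graph_def)
  obtain a where a: "a \<in> M" "a \<in> carrier G" "a \<noteq> \<one>"
    using minimal_subgroup_obtain_non_one[OF M] .
  have x: "x \<in> carrier G" and y: "y \<in> carrier G"
    using z by auto
  have pow_in: "w [^] (t::nat) \<in> generate G {w}" if "w \<in> carrier G" for w t
    using that generate_pow[OF that] by (auto simp: int_pow_int[symmetric])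
  obtain k :: int where k: "a = x [^] k"
    using a(1) assms(4) generate_pow[OF x] by blast
  have "a \<in> generate G {z}"
    using k z generate_pow[OF z(1)]
    by (auto simp: int_pow_int[symmetric] int_pow_pow)
  \<comment> \<open>An infinite carrier would have \<open>order G = 0\<close>. Finiteness turns the
    integer exponent of \<open>a\<close> over \<open>z\<close> into the natural exponent that
    comparability needs.\<close>
  moreover have "order G \<noteq> 0"
    using assms(1,2) by (auto simp: p_group_def prime_gt_0_nat)
  then have "finite (carrier G)"
    by (simp add: order_gt_0_iff_finite[symmetric])
  ultimately obtain l :: nat where l: "a = z [^] l"
    using generate_pow_on_finite_carrier[OF _ z(1)] by blast
  consider (a) t :: nat where "a = y [^] t" | (y) t :: nat where "y = a [^] t"
    using pow_comparable_if_p_group[OF assms(1,2) z(1), of l n] l z(3) by blast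
  then have "a \<in> generate G {y}"
  proof cases
    case a
    then show ?thesis
      using pow_in[OF y] by simp
  next
    case (y t)
    then have "y \<in> M"
      using pow_in[OF \<open>a \<in> carrier G\<close>] generate_eq_minimal_subgroup[OF M a(1,3)] by blast
    then show ?thesis
      using generate_eq_minimal_subgroup[OF M _ \<open>y \<noteq> \<one>\<close>] a(1) by blast
  qed
  then show ?thesis
    using generate_eq_minimal_subgroup[OF M a(1,3)] y a(2)
      generate_singleton_subset_iff[OF generate_is_subgroup[of "{y}"]] by auto
qed

end

theorem theorem5p1:
  fixes G :: "('a, 'b) monoid_scheme" and p :: nat
  assumes "prime p"
    and "p_group p G"
    and "finite (carrier G)"
  shows "Digraph_Component.connected (deleted_enhanced_power_graph G) \<longleftrightarrow>
         (\<exists>!H. minimal_subgroup H G)"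
proof -
  interpret group G
    using assms(2) by (simp add: p_group_def)
  define V where "V = carrier G - {\<one>\<^bsub>G\<^esub>}"
  define E where "E = parcs (enhanced_power_graph G) \<inter> V \<times> V"
  have connected_iff: "Digraph_Component.connected (deleted_enhanced_power_graph G) \<longleftrightarrow>
      V \<noteq> {} \<and> (\<forall>u\<in>V. \<forall>v\<in>V. (u, v) \<in> rtrancl_on V E)"
    unfolding V_def E_def by (rule connected_deleted_enhanced_power_graph_iff)
  show ?thesis
  proof
    assume "Digraph_Component.connected (deleted_enhanced_power_graph G)"
    then have "V \<noteq> {}" and reach: "(u, v) \<in> rtrancl_on V E" if "u \<in> V" "v \<in> V" for u v
      using that connected_iff by blast+
    have "H = K" if H: "minimal_subgroup H G" and K: "minimal_subgroup K G" for H K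
    proof -
      obtain a where a: "a \<in> H" "a \<in> carrier G" "a \<noteq> \<one>\<^bsub>G\<^esub>"
        using minimal_subgroup_obtain_non_one[OF H] .
      obtain b where b: "b \<in> K" "b \<in> carrier G" "b \<noteq> \<one>\<^bsub>G\<^esub>"
        using minimal_subgroup_obtain_non_one[OF K] .
      have "(a, b) \<in> rtrancl_on V E"
        using reach a b by (simp add: V_def)
      \<comment> \<open>The invariant along the path from \<open>a\<close> is that the current
        vertex generates a subgroup containing \<open>H\<close>. At \<open>b\<close> that subgroup
        is \<open>K\<close>, whose minimality then gives \<open>H = K\<close>.\<close>
      then have "H \<subseteq> generate G {b}"
      proof (induction rule: rtrancl_on_induct)
        case base
        show ?case
          using generate_eq_minimal_subgroup[OF H a(1,3)] by simp
      next
        case (step y z)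
        then show ?case
          using minimal_subgroup_le_generate_edge[OF assms(1,2) H] by (auto simp: E_def V_def)
      qed
      then show "H = K"
        using generate_eq_minimal_subgroup[OF K b(1,3)] H K by (simp add: minimal_subgroup_def)
    qed
    \<comment> \<open>Existence: a connected graph has a vertex, so the whole group is nontrivial
      and contains a minimal subgroup.\<close>
    moreover have "carrier G \<noteq> {\<one>\<^bsub>G\<^esub>}"
      using connected_iff \<open>Digraph_Component.connected _\<close> by (auto simp: V_def)
    then have "\<exists>H. minimal_subgroup H G"
      using exists_minimal_subgroup[OF assms(3) subgroup_self] by blast
    ultimately show "\<exists>!H. minimal_subgroup H G"
      by blast
  next
    assume "\<exists>!H. minimal_subgroup H G"
    then obtain H where H: "minimal_subgroup H G" and unique: "\<And>K. minimal_subgroup K G \<Longrightarrow> K = H"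
      by blast
    obtain h where h: "h \<in> H" "h \<in> carrier G" "h \<noteq> \<one>\<^bsub>G\<^esub>"
      using minimal_subgroup_obtain_non_one[OF H] .
    have h_V: "h \<in> V"
      using h by (simp add: V_def)
    \<comment> \<open>The vertex \<open>h\<close> is a hub: the minimal subgroup inside
      \<open>generate G {x}\<close> can only be \<open>H\<close>, so \<open>h\<close> is a power of
      \<open>x\<close>, and \<open>x\<close> itself serves as the common root. Both directions are
      recorded because paths enter and leave \<open>h\<close>.\<close>
    have edge: "x = h \<or> (x, h) \<in> E \<and> (h, x) \<in> E" if "x \<in> V" for x
    proof -
      have x: "x \<in> carrier G" "x \<noteq> \<one>\<^bsub>G\<^esub>"
        using that by (auto simp: V_def)
      then have "H \<subseteq> generate G {x}"
        using exists_minimal_subgroup[OF assms(3) generate_is_subgroup[of "{x}"]]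
          generate_singleton_neq_one[OF x(2)] unique by blast
      then obtain n :: nat where n: "h = x [^]\<^bsub>G\<^esub> n"
        using generate_pow_on_finite_carrier[OF assms(3) x(1)] h(1) by blast
      moreover have "x = x [^]\<^bsub>G\<^esub> (1::nat)"
        using x(1) by simp
      ultimately have "\<exists>z\<in>carrier G. \<exists>(k::nat) (l::nat). x = z [^]\<^bsub>G\<^esub> k \<and> h = z [^]\<^bsub>G\<^esub> l"
        using x(1) by metis
      then show ?thesis
        using h_V that x(1) h(2) by (auto simp: E_def enhanced_power_graph_def)
    qed
    \<comment> \<open>Any two vertices are joined through \<open>h\<close> in at most two
      steps.\<close>
    have "(u, v) \<in> rtrancl_on V E" if "u \<in> V" "v \<in> V" for u v
    proof -
      have "(u, h) \<in> rtrancl_on V E"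
        using edge[OF that(1)] that h_V
        by (metis rtrancl_on.rtrancl_on_refl rtrancl_on_into_rtrancl_on)
      moreover have "(h, v) \<in> rtrancl_on V E"
        using edge[OF that(2)] that h_V
        by (metis rtrancl_on.rtrancl_on_refl rtrancl_on_into_rtrancl_on)
      ultimately show ?thesis
        by (rule rtrancl_on_trans)
    qed
    then show "Digraph_Component.connected (deleted_enhanced_power_graph G)"
      using connected_iff h_V by blast
  qed
qed

end
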